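(* Suppose that $\mathcal A$ is surjective and that the KKT set $\Omega_\star$ is nonempty. Let $\tau,\sigma>0$ satisfy $\tau\sigma\|\mathcal A\|^2<1$, let $\{(X_k,y_k)\}$ be generated by the PDHG iteration from some initial point $(X_0,y_0)\in\mathbb S^n\times\mathbb R^m$, and set $S_k=C-\mathcal A^\ast y_k$. Suppose $(X_k,y_k,S_k)$ converges to a KKT point $(X_\star,y_\star,S_\star)\in\Omega_\star$ satisfying primal--dual nondegeneracy. Then there exist $\rho_{\mathrm{ND}}\in(0,1)$, $\kappa_{\mathrm{ND}}>0$, and an integer $k_{\mathrm{ND}}$ such that, for all $k\ge k_{\mathrm{ND}}$, $$\|(X_{k+1},y_{k+1})-(X_\star,y_\star)\|_P\le\rho_{\mathrm{ND}}\,\|(X_k,y_k)-(X_\star,y_\star)\|_P,$$ and hence $$\|X_k-X_\star\|_{\mathsf F}+\|y_k-y_\star\|_2+\|S_k-S_\star\|_{\mathsf F}\le\kappa_{\mathrm{ND}}\,\rho_{\mathrm{ND}}^{\,k-k_{\mathrm{ND}}}.$$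
   Context: $\mathbb S^n$ is the space of real symmetric $n\times n$ matrices with inner product $\langle X,Y\rangle=\operatorname{tr}(XY)$ and Frobenius norm $\|\cdot\|_{\mathsf F}$; $\mathbb S^n_+$ is the cone of positive semidefinite matrices and $\Pi_{\mathbb S^n_+}$ the Euclidean projection onto it. Data: $C,A_1,\dots,A_m\in\mathbb S^n$, $b\in\mathbb R^m$; $\mathcal A:\mathbb S^n\to\mathbb R^m$, $\mathcal AX=(\langle A_1,X\rangle,\dots,\langle A_m,X\rangle)$, with adjoint $\mathcal A^\ast y=\sum_i y_iA_i$; $\|\mathcal A\|$ is the operator norm induced by the Frobenius and Euclidean norms. The SDP pair is: minimize $\langle C,X\rangle$ subject to $\mathcal AX=b$, $X\in\mathbb S^n_+$; and maximize $b^{\mathsf T}y$ subject to $\mathcal A^\ast y+S=C$, $S\in\mathbb S^n_+$. The KKT set is $$\Omega_\star=\{(X,y,S)\in\mathbb S^n\times\mathbb R^m\times\mathbb S^n\mid \mathcal AX=b,\ X\in\mathbb S^n_+,\ \mathcal A^\ast y+S=C,\ S\in\mathbb S^n_+,\ \langle X,S\rangle=0\};$$ its elements are called KKT points. PDHG iteration: $X_{k+1}=\Pi_{\mathbb S^n_+}\big(X_k-\tau(C-\mathcal A^\ast y_k)\big)$, $\ y_{k+1}=y_k+\sigma\big(b-\mathcal A(2X_{k+1}-X_k)\big)$. Metric: $P=\begin{bmatrix}\tau^{-1}\mathrm{Id}&\mathcal A^\ast\\ \mathcal A&\sigma^{-1}I_m\end{bmatrix}$ on $\mathbb S^n\times\mathbb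 R^m$ (positive definite when $\tau\sigma\|\mathcal A\|^2<1$), with $\|(U,v)\|_P^2=\tau^{-1}\|U\|_{\mathsf F}^2+2v^{\mathsf T}\mathcal AU+\sigma^{-1}\|v\|_2^2$. Primal--dual nondegeneracy: for a KKT point $(X_\star,y_\star,S_\star)$ let $r=\operatorname{rank}X_\star$, $s=\operatorname{rank}S_\star$ (so $r+s\le n$), and let $Q_\star$ be orthogonal with $X_\star=Q_\star\begin{bmatrix}\Lambda_X&0\\0&0\end{bmatrix}Q_\star^{\mathsf T}$, $S_\star=Q_\star\begin{bmatrix}0&0\\0&\Lambda_S\end{bmatrix}Q_\star^{\mathsf T}$, where $\Lambda_X$ ($r\times r$) and $\Lambda_S$ ($s\times s$) are diagonal with positive diagonal entries (such $Q_\star$ exists since $X_\star S_\star=0$). Define $$\mathcal T_{X_\star}=\Big\{Q_\star\begin{bmatrix}H_{11}&H_{21}^{\mathsf T}\\H_{21}&0\end{bmatrix}Q_\star^{\mathsf T}\ \Big|\ H_{11}\in\mathbb S^r,\ H_{21}\in\mathbb R^{(n-r)\times r}\Big\},\qquad \mathcal T_{S_\star}=\Big\{Q_\star\begin{bmatrix}0&H_{21}^{\mathsf T}\\H_{21}&H_{22}\end{bmatrix}Q_\star^{\mathsf T}\ \Big|\ H_{22}\in\mathbb S^s,\ H_{21}\in\mathbb R^{s\times(n-s)}\Big\}.$$ The KKT point satisfies primal--dual nondegeneracy if both $\mathcal T_{X_\star}+\operatorname{Null}(\mathcal A)=\mathbb S^n$ (primal nondegeneracy; equivalently $\mathcal T_{X_\star}^\perp\cap\operatorname{Range}(\mathcal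 A^\ast)=\{0\}$) and $\mathcal T_{S_\star}+\operatorname{Range}(\mathcal A^\ast)=\mathbb S^n$ (dual nondegeneracy; equivalently $\mathcal T_{S_\star}^\perp\cap\operatorname{Null}(\mathcal A)=\{0\}$). *)

theory Defs
  imports "HOL-Analysis.Analysis"
begin

text \<open>
  The space of \<open>n \<times> n\<close> matrices is \<^typ>\<open>real^'n^'n\<close> with \<open>n = CARD('n)\<close>; its library norm and
  distance are the Frobenius ones. The constraint index ranges over the finite type \<open>'m\<close>.
\<close>

definition sym_mats :: "(real^'n^'n) set" where
  "sym_mats = {X. transpose X = X}"

definition psd_cone :: "(real^'n^'n) set" where
  "psd_cone = {X \<in> sym_mats. \<forall>v. 0 \<le> v \<bullet> (X *v v)}"

definition mat_inner :: "real^'n^'n \<Rightarrow> real^'n^'n \<Rightarrow> real" where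
  "mat_inner X Y = trace (X ** Y)"

definition Aop :: "('m::finite \<Rightarrow> real^'n^'n) \<Rightarrow> real^'n^'n \<Rightarrow> real^'m" where
  "Aop A X = (\<chi> i. mat_inner (A i) X)"

definition Aadj :: "('m::finite \<Rightarrow> real^'n^'n) \<Rightarrow> real^'m \<Rightarrow> real^'n^'n" where
  "Aadj A y = (\<Sum>i\<in>UNIV. (y $ i) *\<^sub>R A i)"

text \<open>
  Operator norm of the map restricted to symmetric matrices; the term \<open>X = 0\<close> contributes
  \<open>0 / 0 = 0\<close>, as in \<^const>\<open>onorm\<close>.
\<close>
definition Aop_norm :: "('m::finite \<Rightarrow> real^'n^'n) \<Rightarrow> real" where
  "Aop_norm A = (SUP X\<in>sym_mats. norm (Aop A X) / norm X)"

definition null_A :: "('m::finite \<Rightarrow> real^'n^'n) \<Rightarrow> (real^'n^'n) set" where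
  "null_A A = {X \<in> sym_mats. Aop A X = 0}"

definition KKT_set ::
  "real^'n^'n \<Rightarrow> ('m::finite \<Rightarrow> real^'n^'n) \<Rightarrow> real^'m \<Rightarrow> ((real^'n^'n) \<times> (real^'m) \<times> (real^'n^'n)) set"
  where
  "KKT_set C A b = {(X, y, S). Aop A X = b \<and> X \<in> psd_cone \<and>
     Aadj A y + S = C \<and> S \<in> psd_cone \<and> mat_inner X S = 0}"

definition PDHG_iteration ::
  "real^'n^'n \<Rightarrow> ('m::finite \<Rightarrow> real^'n^'n) \<Rightarrow> real^'m \<Rightarrow> real \<Rightarrow> real
    \<Rightarrow> (nat \<Rightarrow> real^'n^'n) \<Rightarrow> (nat \<Rightarrow> real^'m) \<Rightarrow> bool"
  where
  "PDHG_iteration C A b \<tau> \<sigma> X y \<longleftrightarrow>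
     X 0 \<in> sym_mats \<and>
     (\<forall>k. X (Suc k) = closest_point psd_cone (X k - \<tau> *\<^sub>R (C - Aadj A (y k))) \<and>
          y (Suc k) = y k + \<sigma> *\<^sub>R (b - Aop A (2 *\<^sub>R X (Suc k) - X k)))"

definition P_op ::
  "('m::finite \<Rightarrow> real^'n^'n) \<Rightarrow> real \<Rightarrow> real \<Rightarrow> (real^'n^'n) \<times> (real^'m) \<Rightarrow> (real^'n^'n) \<times> (real^'m)"
  where
  "P_op A \<tau> \<sigma> = (\<lambda>(U, v). (inverse \<tau> *\<^sub>R U + Aadj A v, Aop A U + inverse \<sigma> *\<^sub>R v))"

definition P_norm ::
  "('m::finite \<Rightarrow> real^'n^'n) \<Rightarrow> real \<Rightarrow> real \<Rightarrow> (real^'n^'n) \<times> (real^'m) \<Rightarrow> real"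
  where
  "P_norm A \<tau> \<sigma> z = sqrt (z \<bullet> P_op A \<tau> \<sigma> z)"

definition diag_on :: "'n set \<Rightarrow> ('n \<Rightarrow> real) \<Rightarrow> real^'n^'n" where
  "diag_on I d = (\<chi> i j. if i = j \<and> i \<in> I then d i else 0)"

text \<open>
  The index type carries no order, so the leading \<open>r\<close> and trailing \<open>s\<close> positions of the block
  decompositions are represented by disjoint index sets \<open>I\<close> and \<open>J\<close> with \<open>r = card I\<close> and
  \<open>s = card J\<close>. This amounts to a permutation of the columns of \<open>Q\<close>.
\<close>
definition joint_spectral_decomp ::
  "real^'n^'n \<Rightarrow> real^'n^'n \<Rightarrow> real^'n^'n \<Rightarrow> 'n set \<Rightarrow> 'n set \<Rightarrow> bool"
  where
  "joint_spectral_decomp X S Q I J \<longleftrightarrow>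
     orthogonal_matrix Q \<and> I \<inter> J = {} \<and> card I = rank X \<and> card J = rank S \<and>
     (\<exists>lX. (\<forall>i\<in>I. 0 < lX i) \<and> X = Q ** diag_on I lX ** transpose Q) \<and>
     (\<exists>lS. (\<forall>j\<in>J. 0 < lS j) \<and> S = Q ** diag_on J lS ** transpose Q)"

text \<open>
  Symmetric matrices that, in the basis \<open>Q\<close>, vanish on the block of indices outside \<open>K\<close>. With
  \<open>K = I\<close> this is the space attached to \<open>X\<close>, with \<open>K = J\<close> the one attached to \<open>S\<close>.
\<close>
definition tangent_space :: "real^'n^'n \<Rightarrow> 'n set \<Rightarrow> (real^'n^'n) set" where
  "tangent_space Q K = {Q ** H ** transpose Q | H.
     H \<in> sym_mats \<and> (\<forall>i j. i \<notin> K \<longrightarrow> j \<notin> K \<longrightarrow> H $ i $ j = 0)}"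

text \<open>
  A decomposition exists at every KKT point and the spaces do not depend on which one is chosen.
\<close>
definition primal_dual_nondegenerate ::
  "('m::finite \<Rightarrow> real^'n^'n) \<Rightarrow> real^'n^'n \<Rightarrow> real^'n^'n \<Rightarrow> bool"
  where
  "primal_dual_nondegenerate A X S \<longleftrightarrow>
     (\<exists>Q I J. joint_spectral_decomp X S Q I J \<and>
        {U + V | U V. U \<in> tangent_space Q I \<and> V \<in> null_A A} = sym_mats \<and>
        {U + V | U V. U \<in> tangent_space Q J \<and> V \<in> range (Aadj A)} = sym_mats)"

lemma mat_inner_eq_inner:
  assumes "X \<in> sym_mats"
  shows "mat_inner X Y = X \<bullet> Y"
proof -
  have s: "X $ i $ j = X $ j $ i" for i j
    using assms unfolding sym_mats_def by (metis (mono_tags) mem_Collect_eq transpose_def vec_lambda_beta)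
  have "X \<bullet> Y = (\<Sum>i\<in>UNIV. \<Sum>j\<in>UNIV. X $ i $ j * Y $ i $ j)"
    by (simp add: inner_vec_def)
  also have "\<dots> = (\<Sum>j\<in>UNIV. \<Sum>i\<in>UNIV. X $ i $ j * Y $ i $ j)"
    by (rule sum.swap)
  also have "\<dots> = mat_inner X Y"
    unfolding mat_inner_def trace_def matrix_matrix_mult_def
    by (auto intro!: sum.cong simp: s)
  finally show ?thesis by simp
qed

lemma Aadj_adjoint:
  assumes "\<And>i. A i \<in> sym_mats"
  shows "U \<bullet> Aadj A v = v \<bullet> Aop A U"
  unfolding Aadj_def Aop_def
  by (simp add: inner_sum_right inner_vec_def[of v] mat_inner_eq_inner[OF assms] inner_commute)

lemma P_norm_sq:
  assumes "\<And>i. A i \<in> sym_mats"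
  shows "(U, v) \<bullet> P_op A \<tau> \<sigma> (U, v) =
    inverse \<tau> * (norm U)\<^sup>2 + 2 * (v \<bullet> Aop A U) + inverse \<sigma> * (norm v)\<^sup>2"
  unfolding P_op_def
  by (simp add: inner_Pair inner_add_right Aadj_adjoint[OF assms] power2_norm_eq_inner)

lemma closed_psd_cone: "closed (psd_cone :: (real^'n^'n) set)"
proof -
  have "closed {X :: real^'n^'n. transpose X = X}"
    unfolding transpose_def by (intro closed_Collect_eq continuous_intros)
  moreover have "closed {X :: real^'n^'n. 0 \<le> v \<bullet> (X *v v)}" for v
    unfolding matrix_vector_mult_def by (intro closed_Collect_le continuous_intros)
  ultimately show ?thesis
    unfolding psd_cone_def sym_mats_def
    by (simp add: Collect_conj_eq Collect_all_eq closed_Int closed_INT)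
qed

lemma convex_psd_cone: "convex (psd_cone :: (real^'n^'n) set)"
  unfolding convex_def
proof (intro ballI allI impI)
  fix X Y :: "real^'n^'n" and u v :: real
  assume X: "X \<in> psd_cone" and Y: "Y \<in> psd_cone" and "0 \<le> u" "0 \<le> v"
  have "transpose (u *\<^sub>R X + v *\<^sub>R Y) = u *\<^sub>R transpose X + v *\<^sub>R transpose Y"
    by (simp add: transpose_def vec_eq_iff)
  moreover have "w \<bullet> ((u *\<^sub>R X + v *\<^sub>R Y) *v w) = u * (w \<bullet> (X *v w)) + v * (w \<bullet> (Y *v w))" for w
    by (simp add: matrix_vector_mult_add_rdistrib scaleR_matrix_vector_assoc[symmetric] inner_add_right)
  ultimately show "u *\<^sub>R X + v *\<^sub>R Y \<in> psd_cone"
    using X Y \<open>0 \<le> u\<close> \<open>0 \<le> v\<close> by (auto simp: psd_cone_def sym_mats_def)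
qed

lemma bdd_above_Aop_norm:
  fixes A :: "'m::finite \<Rightarrow> real^'n^'n"
  shows "bdd_above ((\<lambda>X. norm (Aop A X) / norm X) ` sym_mats)"
proof -
  have "linear (Aop A)"
    by (rule linearI) (simp_all add: Aop_def mat_inner_def vec_eq_iff trace_def
        matrix_matrix_mult_def sum_distrib_left sum.distrib algebra_simps)
  then have "bounded_linear (Aop A)"
    by (simp add: linear_conv_bounded_linear)
  then show ?thesis
    using le_onorm by (intro bdd_aboveI2) blast
qed

end

theory Submission imports Defs begin

text \<open>
  PDHG is the proximal point method for the KKT system in the metric \<open>P\<close>. Write \<open>z\<close> for an iterate,
  \<open>z'\<close> for the next one and \<open>z\<^sub>*\<close> for the limit. The projection step produces, next to the primal
  matrix \<open>X'\<close>, a matrix \<open>Z\<close> in the dual cone with \<open>X' Z = 0\<close>, and \<open>P (z - z')\<close> is exactly the residual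
  \<open>(C - A\<^sup>* y' - Z, A X' - b)\<close> of the linear KKT equations (\<open>PDHG_residual\<close>). Monotonicity of the
  KKT system (\<open>KKT_residual_monotone\<close>) gives
  \<open>\<parallel>z' - z\<^sub>*\<parallel>\<^sup>2 + \<parallel>z - z'\<parallel>\<^sup>2 \<le> \<parallel>z - z\<^sub>*\<parallel>\<^sup>2\<close> in the \<open>P\<close>-norm. A contraction follows once
  \<open>\<parallel>z' - z\<^sub>*\<parallel> \<le> M \<parallel>z - z'\<parallel>\<close>, that is, once the distance to the limit is bounded by the KKT residual.

  This local error bound (\<open>complementarity_error_bound\<close>) is where nondegeneracy enters. By
  compactness it fails only if there is a nonzero direction \<open>(H, v, G)\<close> with \<open>A H = 0\<close>,
  \<open>A\<^sup>* v + G = 0\<close> and \<open>X\<^sub>* G + H S\<^sub>* = 0\<close>. The first two equations make \<open>H\<close> and \<open>G\<close> orthogonal. In a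
  joint eigenbasis, the third makes every product \<open>h\<^sub>i\<^sub>j g\<^sub>i\<^sub>j\<close> nonpositive, as soon as \<open>i\<close> belongs to
  the range of \<open>X\<^sub>*\<close> or of \<open>S\<^sub>*\<close>. When strict complementarity fails there is a third
  group of rows; on these the exact equation \<open>(X\<^sub>* + U) (S\<^sub>* + W) = 0\<close> has no linear diagonal term,
  so the diagonal of \<open>U W\<close> vanishes there, and so does that of \<open>H G\<close> in the limit. Thus a sum of
  nonpositive terms is zero, every product vanishes, and \<open>H\<close> and \<open>G\<close> are orthogonal to the tangent
  spaces at \<open>S\<^sub>*\<close> and \<open>X\<^sub>*\<close> respectively. Primal and dual nondegeneracy then force the direction to
  be zero.
\<close>

section \<open>Matrix algebra\<close>

lemma bounded_bilinear_matrix_mult: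
  "bounded_bilinear ((**) :: real^'n^'n \<Rightarrow> real^'n^'n \<Rightarrow> real^'n^'n)"
  unfolding bilinear_conv_bounded_bilinear[symmetric] bilinear_def
  by (auto intro!: linearI simp: matrix_matrix_mult_def vec_eq_iff sum.distrib
      algebra_simps sum_distrib_left)

lemmas matrix_mult_linear =
  bounded_bilinear.add_left[OF bounded_bilinear_matrix_mult]
  bounded_bilinear.add_right[OF bounded_bilinear_matrix_mult]
  bounded_bilinear.scaleR_left[OF bounded_bilinear_matrix_mult]
  bounded_bilinear.scaleR_right[OF bounded_bilinear_matrix_mult]
  bounded_bilinear.minus_left[OF bounded_bilinear_matrix_mult]
  bounded_bilinear.minus_right[OF bounded_bilinear_matrix_mult]

lemmas tendsto_matrix_mult = bounded_bilinear.tendsto[OF bounded_bilinear_matrix_mult]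

lemma transpose_add: "transpose (X + Y :: real^'n^'n) = transpose X + transpose Y"
  by (simp add: transpose_def vec_eq_iff)

lemma inner_trace: "X \<bullet> Y = trace (transpose X ** Y)" for X Y :: "real^'n^'n"
proof -
  have "X \<bullet> Y = (\<Sum>i\<in>UNIV. \<Sum>j\<in>UNIV. X $ i $ j * Y $ i $ j)"
    by (simp add: inner_vec_def)
  also have "\<dots> = (\<Sum>j\<in>UNIV. \<Sum>i\<in>UNIV. X $ i $ j * Y $ i $ j)"
    by (rule sum.swap)
  finally show ?thesis
    by (simp add: trace_def matrix_matrix_mult_def transpose_def)
qed

lemma inner_mult_left: "(B ** X) \<bullet> Y = X \<bullet> (transpose B ** Y)" for X Y B :: "real^'n^'n"
  by (simp add: inner_trace matrix_transpose_mul matrix_mul_assoc)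

lemma inner_mult_right: "(X ** B) \<bullet> Y = X \<bullet> (Y ** transpose B)" for X Y B :: "real^'n^'n"
  by (simp add: inner_trace matrix_transpose_mul matrix_mul_assoc[symmetric]
      trace_mul_sym[of "transpose B"])

lemma inner_transpose: "transpose X \<bullet> transpose Y = X \<bullet> Y" for X Y :: "real^'n^'n"
  by (simp add: inner_vec_def transpose_def) (rule sum.swap)

lemma inner_orthogonal_conjugate:
  fixes Q X Y :: "real^'n^'n"
  assumes "orthogonal_matrix Q"
  shows "(transpose Q ** X ** Q) \<bullet> (transpose Q ** Y ** Q) = X \<bullet> Y"
proof -
  have Q: "Q ** transpose Q = mat 1"
    using assms by (simp add: orthogonal_matrix_def)
  have "(transpose Q ** X ** Q) \<bullet> (transpose Q ** Y ** Q)
      = X \<bullet> (Q ** (transpose Q ** Y ** Q ** transpose Q))"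
    by (simp add: inner_mult_right[of "transpose Q ** X"] inner_mult_left[of "transpose Q" X])
  also have "Q ** (transpose Q ** Y ** Q ** transpose Q) = (Q ** transpose Q) ** Y ** (Q ** transpose Q)"
    by (simp add: matrix_mul_assoc)
  finally show ?thesis by (simp add: Q)
qed

lemma sym_mats_0: "0 \<in> sym_mats"
  by (simp add: sym_mats_def transpose_def vec_eq_iff)

lemma sym_mats_add: "X \<in> sym_mats \<Longrightarrow> Y \<in> sym_mats \<Longrightarrow> X + Y \<in> sym_mats"
  by (simp add: sym_mats_def transpose_add)

lemma sym_mats_scaleR: "X \<in> sym_mats \<Longrightarrow> c *\<^sub>R X \<in> sym_mats"
  by (simp add: sym_mats_def transpose_scalar)

lemma sym_mats_diff: "X \<in> sym_mats \<Longrightarrow> Y \<in> sym_mats \<Longrightarrow> X - Y \<in> sym_mats"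
  using sym_mats_add[of X "(-1) *\<^sub>R Y"] sym_mats_scaleR[of Y "-1"] by simp

lemma sym_mats_conjugate: "X \<in> sym_mats \<Longrightarrow> B ** X ** transpose B \<in> sym_mats"
  by (simp add: sym_mats_def matrix_transpose_mul matrix_mul_assoc)

lemma sym_mats_nth: "X \<in> sym_mats \<Longrightarrow> X $ i $ j = X $ j $ i"
  unfolding sym_mats_def by (metis (mono_tags) mem_Collect_eq transpose_def vec_lambda_beta)

lemma closed_sym_mats: "closed (sym_mats :: (real^'n^'n) set)"
  unfolding sym_mats_def transpose_def by (intro closed_Collect_eq continuous_intros)

lemma psd_cone_sym: "X \<in> psd_cone \<Longrightarrow> X \<in> sym_mats"
  by (simp add: psd_cone_def)

lemma psd_cone_0: "0 \<in> psd_cone"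
  by (simp add: psd_cone_def sym_mats_0)

lemma psd_cone_add: "X \<in> psd_cone \<Longrightarrow> Y \<in> psd_cone \<Longrightarrow> X + Y \<in> psd_cone"
  by (simp add: psd_cone_def sym_mats_add matrix_vector_mult_add_rdistrib inner_add_right)

lemma psd_cone_conjugate:
  assumes "X \<in> psd_cone"
  shows "B ** X ** transpose B \<in> psd_cone"
proof -
  have "v \<bullet> ((B ** X ** transpose B) *v v) = (transpose B *v v) \<bullet> (X *v (transpose B *v v))" for v
    by (metis dot_lmul_matrix matrix_vector_mul_assoc transpose_matrix_vector)
  then show ?thesis
    using assms by (simp add: psd_cone_def sym_mats_conjugate)
qed

text \<open>
  The congruences \<open>(I + t B) X (I + t B)\<^sup>T\<close> stay in the cone, so \<open>t = 0\<close> minimises the inner product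
  with \<open>Z\<close> along each of these curves. Hence the first-order term \<open>2 \<langle>Z X, B\<rangle>\<close> vanishes for
  every \<open>B\<close>; the choice \<open>B = - Z X\<close> gives \<open>Z X = 0\<close>. This bypasses the spectral theorem.
\<close>
lemma psd_complementarity_product:
  assumes X: "X \<in> psd_cone" and Z: "Z \<in> sym_mats"
    and dual: "\<And>Y. Y \<in> psd_cone \<Longrightarrow> 0 \<le> Z \<bullet> Y" and XZ: "Z \<bullet> X = 0"
  shows "X ** Z = 0"
proof -
  define B where "B = - (Z ** X)"
  have Xt: "transpose X = X" and Zt: "transpose Z = Z"
    using X Z by (auto simp: psd_cone_def sym_mats_def)
  define p where "p = (norm (Z ** X))\<^sup>2"
  define q where "q = Z \<bullet> (B ** X ** transpose B)"
  have "(B ** X) \<bullet> Z = B \<bullet> (Z ** X)"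
    by (simp add: inner_mult_right Xt)
  then have BX: "Z \<bullet> (B ** X) = - p"
    by (simp add: B_def p_def inner_commute power2_norm_eq_inner)
  have "X ** transpose B = transpose (B ** X)"
    by (simp add: matrix_transpose_mul Xt)
  then have XB: "Z \<bullet> (X ** transpose B) = - p"
    using BX inner_transpose[of Z "B ** X"] by (simp add: Zt)
  have curve: "2 * p \<le> t * q" if "0 < t" for t
  proof -
    have "(mat 1 + t *\<^sub>R B) ** X ** transpose (mat 1 + t *\<^sub>R B)
        = X + t *\<^sub>R (B ** X) + t *\<^sub>R (X ** transpose B) + t\<^sup>2 *\<^sub>R (B ** X ** transpose B)"
      by (simp add: transpose_add transpose_scalar matrix_mult_linear power2_eq_square algebra_simps)
    then have "0 \<le> Z \<bullet> (X + t *\<^sub>R (B ** X) + t *\<^sub>R (X ** transpose B) + t\<^sup>2 *\<^sub>R (B ** X ** transpose B))"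
      using dual[OF psd_cone_conjugate[OF X, of "mat 1 + t *\<^sub>R B"]] by simp
    also have "\<dots> = t * (t * q - 2 * p)"
      by (simp only: inner_add_right inner_scaleR_right BX XB XZ q_def[symmetric])
        (simp add: algebra_simps power2_eq_square)
    finally show ?thesis
      using that by (simp add: zero_le_mult_iff)
  qed
  have "p = 0"
  proof (rule ccontr)
    assume "p \<noteq> 0"
    then have "0 < p" by (simp add: p_def)
    have "2 * p \<le> p / (\<bar>q\<bar> + 1) * q"
      using \<open>0 < p\<close> by (intro curve) simp
    also have "\<dots> \<le> p"
      using \<open>0 < p\<close> by (simp add: divide_simps mult_left_mono)
    finally show False using \<open>0 < p\<close> by simp
  qed
  then have "transpose (Z ** X) = 0"
    by (simp add: p_def transpose_def vec_eq_iff)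
  then show ?thesis
    by (simp add: matrix_transpose_mul Xt Zt)
qed

section \<open>The constraint map and the metric\<close>

lemma linear_Aop: "linear (Aop A)"
  by (rule linearI) (simp_all add: Aop_def mat_inner_def vec_eq_iff trace_def
      matrix_matrix_mult_def sum_distrib_left sum.distrib algebra_simps)

lemma linear_Aadj: "linear (Aadj A)"
  by (rule linearI) (simp_all add: Aadj_def sum.distrib scaleR_add_left scaleR_sum_right)

lemma Aadj_sym_mats: "(\<And>i. A i \<in> sym_mats) \<Longrightarrow> Aadj A v \<in> sym_mats"
  unfolding Aadj_def sym_mats_def
  by (simp add: transpose_def vec_eq_iff)

lemma Aadj_eq_0_imp:
  assumes A: "\<And>i. A i \<in> sym_mats" and surj: "Aop A ` sym_mats = UNIV" and 0: "Aadj A v = 0"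
  shows "v = 0"
proof -
  obtain U where U: "v = Aop A U" using surj by blast
  have "v \<bullet> v = U \<bullet> Aadj A v"
    using Aadj_adjoint[of A U v] A U by simp
  then show ?thesis using 0 by simp
qed

lemma norm_Aop_le:
  assumes "U \<in> sym_mats"
  shows "norm (Aop A U) \<le> Aop_norm A * norm U"
proof (cases "U = 0")
  case True
  then show ?thesis by (simp add: linear_0[OF linear_Aop])
next
  case False
  have "norm (Aop A U) / norm U \<le> Aop_norm A"
    unfolding Aop_norm_def by (rule cSUP_upper[OF assms bdd_above_Aop_norm])
  then show ?thesis using False by (simp add: divide_simps)
qed

lemma Aop_norm_nonneg:
  fixes A :: "'m::finite \<Rightarrow> real^'n^'n"
  shows "0 \<le> Aop_norm A"
proof -
  have "norm (Aop A 0) / norm (0 :: real^'n^'n) \<le> Aop_norm A"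
    unfolding Aop_norm_def by (rule cSUP_upper[OF sym_mats_0 bdd_above_Aop_norm])
  then show ?thesis by simp
qed

lemma linear_P_op: "linear (P_op A \<tau> \<sigma>)"
  by (rule linearI)
    (auto simp: P_op_def linear_add[OF linear_Aop] linear_add[OF linear_Aadj]
      linear_scale[OF linear_Aop] linear_scale[OF linear_Aadj] algebra_simps)

lemma P_op_self_adjoint:
  assumes "\<And>i. A i \<in> sym_mats"
  shows "z \<bullet> P_op A \<tau> \<sigma> w = w \<bullet> P_op A \<tau> \<sigma> z"
proof -
  obtain U v U' v' where zw: "z = (U, v)" "w = (U', v')"
    by (meson surj_pair)
  show ?thesis
    unfolding zw P_op_def
    by (simp add: inner_Pair inner_add_right Aadj_adjoint[OF assms]
        inner_commute[of U' U] inner_commute[of v' v])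
qed

lemma P_op_quadratic_add:
  assumes "\<And>i. A i \<in> sym_mats"
  shows "(z + w) \<bullet> P_op A \<tau> \<sigma> (z + w)
    = z \<bullet> P_op A \<tau> \<sigma> z + 2 * (z \<bullet> P_op A \<tau> \<sigma> w) + w \<bullet> P_op A \<tau> \<sigma> w"
  using P_op_self_adjoint[OF assms, where z = w and w = z]
  by (simp add: linear_add[OF linear_P_op] inner_add_left inner_add_right)

text \<open>
  With \<open>q = sqrt (\<tau> \<sigma>) * Aop_norm A < 1\<close> the cross term is at most \<open>q\<close> times the sum of the diagonal
  terms, by the arithmetic-geometric mean inequality, so \<open>P\<close> is coercive with constant
  \<open>(1 - q) * min (1 / \<tau>) (1 / \<sigma>)\<close>.
\<close>
lemma P_op_coercive:
  fixes A :: "'m::finite \<Rightarrow> real^'n^'n"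
  assumes A: "\<And>i. A i \<in> sym_mats" and pos: "\<tau> > 0" "\<sigma> > 0"
    and step: "\<tau> * \<sigma> * (Aop_norm A)\<^sup>2 < 1"
  obtains c where "c > 0"
    "\<And>U v. U \<in> sym_mats \<Longrightarrow> c * (norm (U, v))\<^sup>2 \<le> (U, v) \<bullet> P_op A \<tau> \<sigma> (U, v)"
proof
  define a where "a = Aop_norm A"
  define q where "q = sqrt (\<tau> * \<sigma>) * a"
  have "q\<^sup>2 < 1\<^sup>2"
    using step pos by (simp add: q_def a_def power_mult_distrib)
  then have q1: "q < 1"
    by (rule power2_less_imp_less) simp
  define c where "c = (1 - q) * min (1 / \<tau>) (1 / \<sigma>)"
  show "c > 0" using q1 pos by (simp add: c_def)
  fix U :: "real^'n^'n" and v :: "real^'m"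
  assume U: "U \<in> sym_mats"
  have "\<bar>v \<bullet> Aop A U\<bar> \<le> norm v * (a * norm U)"
    unfolding a_def
    by (rule order_trans[OF Cauchy_Schwarz_ineq2 mult_left_mono[OF norm_Aop_le[OF U] norm_ge_zero]])
  moreover have "2 * (norm v * (a * norm U)) \<le> q * ((norm U)\<^sup>2 / \<tau> + (norm v)\<^sup>2 / \<sigma>)"
  proof -
    define u w where "u = norm U / sqrt \<tau>" and "w = norm v / sqrt \<sigma>"
    have "norm v * (a * norm U) = q * (u * w)"
      using pos by (simp add: q_def u_def w_def real_sqrt_mult)
    moreover have "u\<^sup>2 = (norm U)\<^sup>2 / \<tau>" "w\<^sup>2 = (norm v)\<^sup>2 / \<sigma>"
      using pos by (simp_all add: u_def w_def power_divide)
    moreover have "q * (2 * (u * w)) \<le> q * (u\<^sup>2 + w\<^sup>2)"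
      using sum_squares_bound[of u w] pos Aop_norm_nonneg[of A]
      by (intro mult_left_mono) (simp_all add: q_def a_def algebra_simps)
    ultimately show ?thesis by simp
  qed
  ultimately have "(1 - q) * ((norm U)\<^sup>2 / \<tau> + (norm v)\<^sup>2 / \<sigma>) \<le> (U, v) \<bullet> P_op A \<tau> \<sigma> (U, v)"
    unfolding P_norm_sq[OF A] by (simp add: algebra_simps divide_inverse)
  moreover have "c * (norm (U, v))\<^sup>2 \<le> (1 - q) * ((norm U)\<^sup>2 / \<tau> + (norm v)\<^sup>2 / \<sigma>)"
  proof -
    have "min (1 / \<tau>) (1 / \<sigma>) * (norm U)\<^sup>2 \<le> (1 / \<tau>) * (norm U)\<^sup>2"
      "min (1 / \<tau>) (1 / \<sigma>) * (norm v)\<^sup>2 \<le> (1 / \<sigma>) * (norm v)\<^sup>2"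
      by (intro mult_right_mono; simp)+
    then have "min (1 / \<tau>) (1 / \<sigma>) * ((norm U)\<^sup>2 + (norm v)\<^sup>2) \<le> (norm U)\<^sup>2 / \<tau> + (norm v)\<^sup>2 / \<sigma>"
      by (simp add: distrib_left)
    then show ?thesis
      using q1 by (simp add: c_def norm_Pair mult.assoc mult_left_mono)
  qed
  ultimately show "c * (norm (U, v))\<^sup>2 \<le> (U, v) \<bullet> P_op A \<tau> \<sigma> (U, v)" by linarith
qed

lemma P_norm_equivalent:
  fixes A :: "'m::finite \<Rightarrow> real^'n^'n"
  assumes A: "\<And>i. A i \<in> sym_mats" and pos: "\<tau> > 0" "\<sigma> > 0"
    and step: "\<tau> * \<sigma> * (Aop_norm A)\<^sup>2 < 1"
  obtains c1 c2 where "c1 > 0" "c2 > 0"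
    "\<And>U v. U \<in> sym_mats \<Longrightarrow> norm (U, v) \<le> c1 * P_norm A \<tau> \<sigma> (U, v)"
    "\<And>z. P_norm A \<tau> \<sigma> z \<le> c2 * norm z"
    "\<And>U v. U \<in> sym_mats \<Longrightarrow> (P_norm A \<tau> \<sigma> (U, v))\<^sup>2 = (U, v) \<bullet> P_op A \<tau> \<sigma> (U, v)"
proof -
  obtain c where c: "c > 0"
    and le: "\<And>U v. U \<in> sym_mats \<Longrightarrow> c * (norm (U, v))\<^sup>2 \<le> (U, v) \<bullet> P_op A \<tau> \<sigma> (U, v)"
    using P_op_coercive[OF A pos step] by blast
  obtain K where K: "K > 0" "\<And>z. norm (P_op A \<tau> \<sigma> z) \<le> K * norm z"
    using linear_bounded_pos[OF linear_P_op, of A \<tau> \<sigma>] by auto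
  show ?thesis
  proof (rule that[of "1 / sqrt c" "sqrt K"])
    show "1 / sqrt c > 0" "sqrt K > 0" using c K by auto
    show "norm (U, v) \<le> 1 / sqrt c * P_norm A \<tau> \<sigma> (U, v)" if "U \<in> sym_mats" for U v
    proof -
      have "sqrt c * norm (U, v) = sqrt (c * (norm (U, v))\<^sup>2)"
        by (simp add: real_sqrt_mult)
      also have "\<dots> \<le> P_norm A \<tau> \<sigma> (U, v)"
        unfolding P_norm_def using le[OF that] by simp
      finally show ?thesis using c by (simp add: field_simps)
    qed
    show "P_norm A \<tau> \<sigma> z \<le> sqrt K * norm z" for z
    proof -
      have "z \<bullet> P_op A \<tau> \<sigma> z \<le> norm z * (K * norm z)"
        using norm_cauchy_schwarz[of z "P_op A \<tau> \<sigma> z"] K(2)[of z]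
        by (meson mult_left_mono norm_ge_zero order_trans)
      then have "P_norm A \<tau> \<sigma> z \<le> sqrt (K * (norm z)\<^sup>2)"
        unfolding P_norm_def by (intro real_sqrt_le_mono) (simp add: power2_eq_square mult_ac)
      then show ?thesis by (simp add: real_sqrt_mult)
    qed
    show "(P_norm A \<tau> \<sigma> (U, v))\<^sup>2 = (U, v) \<bullet> P_op A \<tau> \<sigma> (U, v)" if "U \<in> sym_mats" for U v
    proof -
      have "0 \<le> c * (norm (U, v))\<^sup>2" using c by simp
      then show ?thesis unfolding P_norm_def using le[OF that, of v] by simp
    qed
  qed
qed

section \<open>Nondegeneracy and the complementarity equation\<close>

lemma diag_on_mult_nth: "(diag_on I d ** M) $ i $ j = (if i \<in> I then d i * M $ i $ j else 0)"
proof -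
  have "diag_on I d $ i $ k * M $ k $ j = (if k = i then (if i \<in> I then d i * M $ i $ j else 0) else 0)" for k
    by (auto simp: diag_on_def)
  then show ?thesis by (simp add: matrix_matrix_mult_def)
qed

lemma mult_diag_on_nth: "(M ** diag_on I d) $ i $ j = (if j \<in> I then M $ i $ j * d j else 0)"
proof -
  have "M $ i $ k * diag_on I d $ k $ j = (if k = j then (if j \<in> I then M $ i $ j * d j else 0) else 0)" for k
    by (auto simp: diag_on_def)
  then show ?thesis by (simp add: matrix_matrix_mult_def)
qed

text \<open>
  The form that \<open>X G + H S\<close> takes in the eigenbasis. Both summands vanish at positions \<open>(i, j)\<close>
  with \<open>i \<notin> I\<close> and \<open>j \<notin> J\<close>, which is where second-order information must enter.
\<close>
lemma joint_spectral_decomp_entries: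
  fixes X S Q :: "real^'n^'n"
  assumes "joint_spectral_decomp X S Q I J"
  obtains lX lS where "\<And>i. i \<in> I \<Longrightarrow> 0 < lX i" "\<And>j. j \<in> J \<Longrightarrow> 0 < lS j"
    "\<And>H G i j. (transpose Q ** (X ** G + H ** S) ** Q) $ i $ j
      = (if i \<in> I then lX i * (transpose Q ** G ** Q) $ i $ j else 0)
      + (if j \<in> J then (transpose Q ** H ** Q) $ i $ j * lS j else 0)"
proof -
  obtain lX lS where pos: "\<And>i. i \<in> I \<Longrightarrow> 0 < lX i" "\<And>j. j \<in> J \<Longrightarrow> 0 < lS j"
    and X: "X = Q ** diag_on I lX ** transpose Q" and S: "S = Q ** diag_on J lS ** transpose Q"
    and Q: "orthogonal_matrix Q"
    using assms unfolding joint_spectral_decomp_def by blast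
  have Q: "transpose Q ** Q = mat 1"
    using Q by (simp add: orthogonal_matrix_def)
  have "transpose Q ** (X ** G + H ** S) ** Q
      = diag_on I lX ** (transpose Q ** G ** Q) + (transpose Q ** H ** Q) ** diag_on J lS" for G H
  proof -
    have "transpose Q ** (X ** G) ** Q = (transpose Q ** Q) ** diag_on I lX ** (transpose Q ** G ** Q)"
      unfolding X by (simp only: matrix_mul_assoc)
    moreover have "transpose Q ** (H ** S) ** Q
        = (transpose Q ** H ** Q) ** diag_on J lS ** (transpose Q ** Q)"
      unfolding S by (simp only: matrix_mul_assoc)
    ultimately show ?thesis by (simp add: Q matrix_mult_linear)
  qed
  then show ?thesis
    by (intro that[of lX lS]) (simp_all add: pos diag_on_mult_nth mult_diag_on_nth)
qed

text \<open>
  In the eigenbasis the linearised equation reads \<open>\<lambda>\<^sub>i g\<^sub>i\<^sub>j = - h\<^sub>i\<^sub>j \<mu>\<^sub>j\<close> on \<open>I \<times> J\<close> and forces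
  \<open>g\<^sub>i\<^sub>j = 0\<close> for \<open>i \<in> I\<close>, \<open>j \<notin> J\<close> and \<open>h\<^sub>i\<^sub>j = 0\<close> for \<open>i \<notin> I\<close>, \<open>j \<in> J\<close>. Hence every product
  \<open>h\<^sub>i\<^sub>j g\<^sub>j\<^sub>i\<close> with \<open>i \<in> I \<union> J\<close> is nonpositive. The remaining rows contribute the diagonal
  entries of \<open>H G\<close>, which vanish by hypothesis, so orthogonality of \<open>H\<close> and \<open>G\<close> kills every
  product, and on \<open>I \<times> J\<close> also both factors.
\<close>
lemma linearised_complementarity_orthogonal:
  fixes X S Q H G :: "real^'n^'n"
  assumes dec: "joint_spectral_decomp X S Q I J"
    and H: "H \<in> sym_mats" and G: "G \<in> sym_mats"
    and lin: "X ** G + H ** S = 0" and orth: "H \<bullet> G = 0"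
    and diag: "\<And>i. i \<notin> I \<union> J \<Longrightarrow> (transpose Q ** (H ** G) ** Q) $ i $ i = 0"
  shows "j \<in> J \<Longrightarrow> (transpose Q ** H ** Q) $ j $ k = 0"
    and "i \<in> I \<Longrightarrow> (transpose Q ** G ** Q) $ i $ k = 0"
proof -
  have Q: "orthogonal_matrix Q" and disj: "I \<inter> J = {}"
    using dec by (auto simp: joint_spectral_decomp_def)
  have QQ: "Q ** transpose Q = mat 1" using Q by (simp add: orthogonal_matrix_def)
  obtain lX lS where pos: "\<And>i. i \<in> I \<Longrightarrow> 0 < lX i" "\<And>j. j \<in> J \<Longrightarrow> 0 < lS j"
    and entry: "\<And>H G i j. (transpose Q ** (X ** G + H ** S) ** Q) $ i $ j
      = (if i \<in> I then lX i * (transpose Q ** G ** Q) $ i $ j else 0)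
      + (if j \<in> J then (transpose Q ** H ** Q) $ i $ j * lS j else 0)"
    using joint_spectral_decomp_entries[OF dec] by blast
  define h where "h = transpose Q ** H ** Q"
  define g where "g = transpose Q ** G ** Q"
  have hs: "h $ i $ j = h $ j $ i" and gs: "g $ i $ j = g $ j $ i" for i j
    using sym_mats_conjugate[OF H, of "transpose Q"] sym_mats_conjugate[OF G, of "transpose Q"]
    by (simp_all add: h_def g_def sym_mats_nth)
  have Q0: "transpose Q ** 0 ** Q = 0"
    by (simp add: bounded_bilinear.zero_left[OF bounded_bilinear_matrix_mult]
        bounded_bilinear.zero_right[OF bounded_bilinear_matrix_mult])
  have eq: "(if i \<in> I then lX i * g $ i $ j else 0) + (if j \<in> J then h $ i $ j * lS j else 0) = 0" for i j
    unfolding h_def g_def entry[symmetric] lin Q0 by simp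
  have gI: "g $ i $ j = 0" if "i \<in> I" "j \<notin> J" for i j
    using eq[of i j] that pos(1)[of i] by simp
  have hJ: "h $ i $ j = 0" if "i \<notin> I" "j \<in> J" for i j
    using eq[of i j] that pos(2)[of j] by simp
  have gIJ: "g $ i $ j = - (lS j / lX i) * h $ i $ j" if "i \<in> I" "j \<in> J" for i j
    using eq[of i j] that pos(1)[of i] by (simp add: field_simps)
  have IJ: "h $ i $ j * g $ i $ j \<le> 0" if "i \<in> I" "j \<in> J" for i j
  proof -
    have "h $ i $ j * g $ i $ j = - (lS j / lX i) * (h $ i $ j)\<^sup>2"
      using gIJ[OF that] by (simp add: power2_eq_square)
    then show ?thesis
      using pos(1)[OF that(1)] pos(2)[OF that(2)] by simp
  qed
  have nonpos: "h $ i $ j * g $ i $ j \<le> 0" if "i \<in> I \<union> J" for i j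
  proof (cases "i \<in> I")
    case True
    then show ?thesis using IJ[of i j] gI[of i j] by (cases "j \<in> J") auto
  next
    case False
    then have "i \<in> J" using that by simp
    then show ?thesis
      using IJ[of j i] hJ[of j i] hs[of i j] gs[of i j] by (cases "j \<in> I") auto
  qed
  have hg: "transpose Q ** (H ** G) ** Q = h ** g"
  proof -
    have "h ** g = transpose Q ** H ** (Q ** transpose Q) ** G ** Q"
      by (simp only: h_def g_def matrix_mul_assoc)
    then show ?thesis by (simp add: QQ matrix_mul_assoc)
  qed
  have outside: "(\<Sum>j\<in>UNIV. h $ i $ j * g $ i $ j) = 0" if "i \<notin> I \<union> J" for i
  proof -
    have "(h ** g) $ i $ i = 0" using diag[OF that] by (simp only: hg)
    then show ?thesis by (simp add: matrix_matrix_mult_def gs[of i])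
  qed
  have row_le: "(\<Sum>j\<in>UNIV. h $ i $ j * g $ i $ j) \<le> 0" for i
    using outside[of i] nonpos[of i] by (cases "i \<in> I \<union> J") (auto intro: sum_nonpos)
  have "(\<Sum>i\<in>UNIV. \<Sum>j\<in>UNIV. h $ i $ j * g $ i $ j) = h \<bullet> g"
    by (simp add: inner_vec_def)
  also have "\<dots> = 0"
    using inner_orthogonal_conjugate[OF Q, of H G] orth by (simp add: h_def g_def)
  finally have "(\<Sum>i\<in>UNIV. \<Sum>j\<in>UNIV. h $ i $ j * g $ i $ j) = 0" .
  then have row: "(\<Sum>j\<in>UNIV. h $ i $ j * g $ i $ j) = 0" for i
    using sum_nonneg_eq_0_iff[of UNIV "\<lambda>i. - (\<Sum>j\<in>UNIV. h $ i $ j * g $ i $ j)"] row_le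
    unfolding sum_negf by simp
  have prod: "h $ i $ j * g $ i $ j = 0" if "i \<in> I" for i j
    using sum_nonneg_eq_0_iff[of UNIV "\<lambda>j. - (h $ i $ j * g $ i $ j)"] row[of i] nonpos[of i] that
    unfolding sum_negf by simp
  have zero: "h $ i $ j = 0 \<and> g $ i $ j = 0" if "i \<in> I" "j \<in> J" for i j
  proof -
    have "lS j / lX i * (h $ i $ j)\<^sup>2 = 0"
      using prod[OF that(1), of j] gIJ[OF that] by (auto simp: power2_eq_square)
    then have "h $ i $ j = 0"
      using pos(1)[OF that(1)] pos(2)[OF that(2)] by simp
    then show ?thesis using gIJ[OF that] by simp
  qed
  show "(transpose Q ** H ** Q) $ j $ k = 0" if "j \<in> J"
    using zero[of k j] hJ[of k j] hs[of j k] that by (cases "k \<in> I") (simp_all add: h_def)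
  show "(transpose Q ** G ** Q) $ i $ k = 0" if "i \<in> I"
    using zero[of i k] gI[of i k] that by (cases "k \<in> J") (simp_all add: g_def)
qed

lemma tangent_space_orthogonal:
  fixes Q M U :: "real^'n^'n"
  assumes Q: "orthogonal_matrix Q" and U: "U \<in> tangent_space Q K" and M: "M \<in> sym_mats"
    and zero: "\<And>i j. i \<in> K \<Longrightarrow> (transpose Q ** M ** Q) $ i $ j = 0"
  shows "M \<bullet> U = 0"
proof -
  obtain N where N: "U = Q ** N ** transpose Q" "\<And>i j. i \<notin> K \<Longrightarrow> j \<notin> K \<Longrightarrow> N $ i $ j = 0"
    using U unfolding tangent_space_def by blast
  have "transpose Q ** U ** Q = (transpose Q ** Q) ** N ** (transpose Q ** Q)"
    unfolding N(1) by (simp only: matrix_mul_assoc)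
  then have QU: "transpose Q ** U ** Q = N"
    using Q by (simp add: orthogonal_matrix_def)
  have "(transpose Q ** M ** Q) $ i $ j * N $ i $ j = 0" for i j
    using zero[of i j] zero[of j i] N(2)[of i j] sym_mats_conjugate[OF M, of "transpose Q"]
      sym_mats_nth[of "transpose Q ** M ** Q" i j]
    by auto
  then have "(transpose Q ** M ** Q) \<bullet> N = 0"
    unfolding inner_vec_def inner_real_def by (intro sum.neutral ballI)
  then show ?thesis
    using inner_orthogonal_conjugate[OF Q, of M U] QU by simp
qed

text \<open>
  A direction \<open>H\<close> that vanishes on the rows indexed by \<open>J\<close> is orthogonal to the tangent space at
  \<open>S\<close>, and one in the kernel of the constraint map is orthogonal to the range of the adjoint;
  dual nondegeneracy says that these two spaces span everything, so \<open>H = 0\<close>. The same argument with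
  primal nondegeneracy applies to \<open>G\<close>, and surjectivity then removes \<open>v\<close>.
\<close>
lemma nondegenerate_linearisation_trivial:
  fixes A :: "'m::finite \<Rightarrow> real^'n^'n" and X S Q H G :: "real^'n^'n"
  assumes A: "\<And>i. A i \<in> sym_mats" and surj: "Aop A ` sym_mats = UNIV"
    and dec: "joint_spectral_decomp X S Q I J"
    and primal: "{U + V | U V. U \<in> tangent_space Q I \<and> V \<in> null_A A} = sym_mats"
    and dual: "{U + V | U V. U \<in> tangent_space Q J \<and> V \<in> range (Aadj A)} = sym_mats"
    and H: "H \<in> sym_mats" and G: "G \<in> sym_mats"
    and AH: "Aop A H = 0" and AG: "Aadj A v + G = 0"
    and lin: "X ** G + H ** S = 0"
    and diag: "\<And>i. i \<notin> I \<union> J \<Longrightarrow> (transpose Q ** (H ** G) ** Q) $ i $ i = 0"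
  shows "H = 0 \<and> v = 0 \<and> G = 0"
proof -
  have Q: "orthogonal_matrix Q"
    using dec by (simp add: joint_spectral_decomp_def)
  have G_eq: "G = - Aadj A v" using AG by (simp add: eq_neg_iff_add_eq_0 add.commute)
  have orth: "H \<bullet> G = 0"
    using Aadj_adjoint[of A H v, OF A] AH by (simp add: G_eq)
  note zero = linearised_complementarity_orthogonal[OF dec H G lin orth diag]
  obtain U w where Hdec: "H = U + Aadj A w" "U \<in> tangent_space Q J"
    using H dual by blast
  have "H \<bullet> H = H \<bullet> U + H \<bullet> Aadj A w"
    by (subst (2) Hdec(1)) (simp add: inner_add_right)
  also have "\<dots> = 0"
    using tangent_space_orthogonal[OF Q Hdec(2) H zero(1)] Aadj_adjoint[of A H w, OF A] AH by simp
  finally have "H = 0" by simp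
  obtain U' V where Gdec: "G = U' + V" "U' \<in> tangent_space Q I" "V \<in> null_A A"
    using G primal by blast
  have "G \<bullet> G = G \<bullet> U' + G \<bullet> V"
    by (subst (2) Gdec(1)) (simp add: inner_add_right)
  also have "\<dots> = 0"
    using tangent_space_orthogonal[OF Q Gdec(2) G zero(2)] Aadj_adjoint[of A V v, OF A] Gdec(3)
    by (simp add: G_eq null_A_def inner_commute)
  finally have "G = 0" by simp
  then have "v = 0"
    using Aadj_eq_0_imp[OF A surj, of v] AG by simp
  with \<open>H = 0\<close> \<open>G = 0\<close> show ?thesis by simp
qed

text \<open>
  By compactness. If the bound failed, normalised violating triples would have a limit \<open>(H, v, G)\<close> of
  norm one that solves the linear equations and \<open>X G + H S = 0\<close>, the linearisation of
  \<open>(X + U) (S + W) = 0\<close>. The diagonal entries of the latter equation outside \<open>I \<union> J\<close> have no linear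
  part, so there \<open>U W\<close> itself vanishes and the limit inherits the second-order condition that
  the linearisation loses when \<open>rank X + rank S < n\<close>.
\<close>
lemma complementarity_error_bound:
  fixes A :: "'m::finite \<Rightarrow> real^'n^'n" and X S :: "real^'n^'n"
  assumes A: "\<And>i. A i \<in> sym_mats" and surj: "Aop A ` sym_mats = UNIV"
    and XS: "X ** S = 0" and nd: "primal_dual_nondegenerate A X S"
  obtains c \<delta> :: real where "c > 0" "\<delta> > 0"
    "\<And>U v W. U \<in> sym_mats \<Longrightarrow> W \<in> sym_mats \<Longrightarrow> norm U < \<delta> \<Longrightarrow> (X + U) ** (S + W) = 0 \<Longrightarrow>
      norm (U, v) \<le> c * (norm (Aop A U) + norm (Aadj A v + W))"
proof -
  obtain Q I J where dec: "joint_spectral_decomp X S Q I J"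
    and primal: "{U + V | U V. U \<in> tangent_space Q I \<and> V \<in> null_A A} = sym_mats"
    and dual: "{U + V | U V. U \<in> tangent_space Q J \<and> V \<in> range (Aadj A)} = sym_mats"
    using nd unfolding primal_dual_nondegenerate_def by blast
  have "\<exists>c>0. \<exists>\<delta>>0. \<forall>U v W. U \<in> sym_mats \<longrightarrow> W \<in> sym_mats \<longrightarrow> norm U < \<delta> \<longrightarrow>
      (X + U) ** (S + W) = 0 \<longrightarrow> norm (U, v) \<le> c * (norm (Aop A U) + norm (Aadj A v + W))"
  proof (rule ccontr)
    assume neg: "\<not> ?thesis"
    have "\<exists>U v W. U \<in> sym_mats \<and> W \<in> sym_mats \<and> norm U < 1 / real (Suc n) \<and> (X + U) ** (S + W) = 0
        \<and> real (Suc n) * (norm (Aop A U) + norm (Aadj A v + W)) < norm (U, v)" for n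
    proof -
      have "real (Suc n) > 0" "1 / real (Suc n) > 0" by simp_all
      with neg show ?thesis by (meson not_le)
    qed
    then obtain U v W where sym: "\<And>n. U n \<in> sym_mats" "\<And>n. W n \<in> sym_mats"
      and small: "\<And>n. norm (U n) < 1 / real (Suc n)"
      and compl: "\<And>n. (X + U n) ** (S + W n) = 0"
      and viol: "\<And>n. real (Suc n) * (norm (Aop A (U n)) + norm (Aadj A (v n) + W n)) < norm (U n, v n)"
      by metis
    define t where "t n = norm (U n, v n, W n)" for n
    have uv_le: "norm (U n, v n) \<le> t n" for n
      by (simp add: t_def norm_Pair)
    have t_pos: "t n > 0" for n
    proof -
      have "0 \<le> real (Suc n) * (norm (Aop A (U n)) + norm (Aadj A (v n) + W n))" by simp
      then show ?thesis using viol[of n] uv_le[of n] by linarith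
    qed
    define H where "H n = (1 / t n) *\<^sub>R U n" for n
    define h where "h n = (1 / t n) *\<^sub>R v n" for n
    define G where "G n = (1 / t n) *\<^sub>R W n" for n
    have unit: "norm (H n, h n, G n) = 1" for n
    proof -
      have "(H n, h n, G n) = (1 / t n) *\<^sub>R (U n, v n, W n)"
        by (simp add: H_def h_def G_def)
      then have "norm (H n, h n, G n) = (1 / t n) * t n"
        using t_pos[of n] by (simp only: norm_scaleR t_def[symmetric]) simp
      then show ?thesis using t_pos[of n] by simp
    qed
    have "compact (sphere (0 :: (real^'n^'n) \<times> (real^'m) \<times> (real^'n^'n)) 1)"
      by (rule compact_sphere)
    moreover have "\<forall>n. (H n, h n, G n) \<in> sphere 0 1"
      using unit by simp
    ultimately obtain l r where l: "l \<in> sphere 0 1" and r: "strict_mono r"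
      and lim: "((\<lambda>n. (H n, h n, G n)) \<circ> r) \<longlonglongrightarrow> l"
      unfolding compact_def by meson
    obtain H0 h0 G0 where l_eq: "l = (H0, h0, G0)"
      by (metis surj_pair)
    have limH: "(\<lambda>n. H (r n)) \<longlonglongrightarrow> H0"
      using tendsto_fst[OF lim] by (simp add: l_eq comp_def)
    have limh: "(\<lambda>n. h (r n)) \<longlonglongrightarrow> h0"
      using tendsto_fst[OF tendsto_snd[OF lim]] by (simp add: l_eq comp_def)
    have limG: "(\<lambda>n. G (r n)) \<longlonglongrightarrow> G0"
      using tendsto_snd[OF tendsto_snd[OF lim]] by (simp add: l_eq comp_def)
    have recip: "(\<lambda>n. 1 / real (Suc (r n))) \<longlonglongrightarrow> 0"
      using LIMSEQ_subseq_LIMSEQ[OF LIMSEQ_inverse_real_of_nat r]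
      by (simp add: comp_def inverse_eq_divide)
    have limU: "(\<lambda>n. U (r n)) \<longlonglongrightarrow> 0"
      by (rule tendsto_norm_zero_cancel, rule tendsto_sandwich[OF _ _ tendsto_const recip])
        (auto intro!: always_eventually less_imp_le[OF small] simp del: of_nat_Suc)
    have resid: "norm (Aop A (H n)) + norm (Aadj A (h n) + G n) \<le> 1 / real (Suc n)" for n
    proof -
      have "Aop A (H n) = (1 / t n) *\<^sub>R Aop A (U n)"
        "Aadj A (h n) + G n = (1 / t n) *\<^sub>R (Aadj A (v n) + W n)"
        by (simp_all add: H_def h_def G_def linear_scale[OF linear_Aop] linear_scale[OF linear_Aadj]
            scaleR_add_right)
      then have "norm (Aop A (H n)) + norm (Aadj A (h n) + G n)
          = (1 / t n) * (norm (Aop A (U n)) + norm (Aadj A (v n) + W n))"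
        using t_pos[of n] by (simp add: add_divide_distrib)
      also have "\<dots> \<le> (1 / t n) * (t n / real (Suc n))"
      proof (rule mult_left_mono)
        have "(norm (Aop A (U n)) + norm (Aadj A (v n) + W n)) * real (Suc n) \<le> t n"
          using viol[of n] uv_le[of n] by (simp only: mult.commute[of _ "real (Suc n)"])
        then show "norm (Aop A (U n)) + norm (Aadj A (v n) + W n) \<le> t n / real (Suc n)"
          by (simp only: pos_le_divide_eq of_nat_0_less_iff zero_less_Suc)
      qed (use t_pos[of n] in simp)
      finally show ?thesis using t_pos[of n] by simp
    qed
    have expand: "X ** W n + U n ** S + U n ** W n = 0" for n
      using compl[of n] XS by (simp add: matrix_mult_linear algebra_simps)
    have "Aop A H0 = 0"
    proof -
      have "(\<lambda>n. Aop A (H (r n))) \<longlonglongrightarrow> 0"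
        by (rule tendsto_norm_zero_cancel, rule tendsto_sandwich[OF _ _ tendsto_const recip])
          (auto intro!: always_eventually order_trans[OF _ resid] simp del: of_nat_Suc)
      moreover have "(\<lambda>n. Aop A (H (r n))) \<longlonglongrightarrow> Aop A H0"
        by (rule bounded_linear.tendsto[OF _ limH]) (simp add: linear_conv_bounded_linear[symmetric] linear_Aop)
      ultimately show ?thesis using LIMSEQ_unique by blast
    qed
    moreover have "Aadj A h0 + G0 = 0"
    proof -
      have "(\<lambda>n. Aadj A (h (r n)) + G (r n)) \<longlonglongrightarrow> 0"
        by (rule tendsto_norm_zero_cancel, rule tendsto_sandwich[OF _ _ tendsto_const recip])
          (auto intro!: always_eventually order_trans[OF _ resid] simp del: of_nat_Suc)
      moreover have "(\<lambda>n. Aadj A (h (r n)) + G (r n)) \<longlonglongrightarrow> Aadj A h0 + G0"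
        by (rule tendsto_add[OF bounded_linear.tendsto[OF _ limh] limG])
          (simp add: linear_conv_bounded_linear[symmetric] linear_Aadj)
      ultimately show ?thesis using LIMSEQ_unique by blast
    qed
    moreover have "X ** G0 + H0 ** S = 0"
    proof -
      have "X ** G n + H n ** S + U n ** G n = 0" for n
      proof -
        have "X ** G n + H n ** S + U n ** G n = (1 / t n) *\<^sub>R (X ** W n + U n ** S + U n ** W n)"
          by (simp only: H_def G_def matrix_mult_linear scaleR_add_right)
        then show ?thesis by (simp add: expand)
      qed
      moreover have "(\<lambda>n. X ** G (r n) + H (r n) ** S + U (r n) ** G (r n)) \<longlonglongrightarrow> X ** G0 + H0 ** S + 0 ** G0"
        by (intro tendsto_add tendsto_matrix_mult tendsto_const limG limH limU)
      ultimately have "X ** G0 + H0 ** S + 0 ** G0 = 0"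
        by (simp add: LIMSEQ_const_iff)
      then show ?thesis
        by (simp add: bounded_bilinear.zero_left[OF bounded_bilinear_matrix_mult])
    qed
    moreover have "(transpose Q ** (H0 ** G0) ** Q) $ i $ i = 0" if i: "i \<notin> I \<union> J" for i
    proof -
      obtain lX lS where entry: "\<And>H G i j. (transpose Q ** (X ** G + H ** S) ** Q) $ i $ j
          = (if i \<in> I then lX i * (transpose Q ** G ** Q) $ i $ j else 0)
          + (if j \<in> J then (transpose Q ** H ** Q) $ i $ j * lS j else 0)"
        using joint_spectral_decomp_entries[OF dec] by metis
      have "(transpose Q ** (H n ** G n) ** Q) $ i $ i = 0" for n
      proof -
        have "U n ** W n = - (X ** W n + U n ** S)"
          using expand[of n] by (metis add_eq_0_iff)
        moreover have "H n ** G n = (1 / t n)\<^sup>2 *\<^sub>R (U n ** W n)"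
          by (simp add: H_def G_def matrix_mult_linear power2_eq_square)
        ultimately have UW: "H n ** G n = - ((1 / t n)\<^sup>2) *\<^sub>R (X ** W n + U n ** S)"
          by (simp only: scaleR_minus_left scaleR_minus_right)
        show ?thesis
          unfolding UW matrix_mult_linear vector_scaleR_component
          using i entry[where G = "W n" and H = "U n" and i = i and j = i] by (simp add: matrix_mult_linear)
      qed
      moreover have "(\<lambda>n. (transpose Q ** (H (r n) ** G (r n)) ** Q) $ i $ i)
          \<longlonglongrightarrow> (transpose Q ** (H0 ** G0) ** Q) $ i $ i"
        by (intro tendsto_vec_nth tendsto_matrix_mult tendsto_const limG limH)
      ultimately show ?thesis by (simp add: LIMSEQ_const_iff)
    qed
    moreover have "H0 \<in> sym_mats"
      using closed_sequentially[OF closed_sym_mats _ limH] sym by (simp add: H_def sym_mats_scaleR)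
    moreover have "G0 \<in> sym_mats"
      using closed_sequentially[OF closed_sym_mats _ limG] sym by (simp add: G_def sym_mats_scaleR)
    ultimately have "H0 = 0 \<and> h0 = 0 \<and> G0 = 0"
      using nondegenerate_linearisation_trivial[OF A surj dec primal dual] by blast
    then show False using l l_eq by simp
  qed
  then show ?thesis using that by blast
qed

section \<open>One step of the iteration\<close>

text \<open>
  The variational inequality of the projection, tested with \<open>X' + Y\<close>, puts \<open>Z\<close> into the dual
  cone; tested with \<open>0\<close>, it then makes \<open>Z\<close> orthogonal to \<open>X'\<close>. In the iteration, \<open>Z\<close> is the dual
  slack that belongs to the new primal iterate \<open>X'\<close>.
\<close>
lemma psd_projection_residual:
  fixes X W :: "real^'n^'n"
  assumes W: "W \<in> sym_mats" and tau: "\<tau> > 0"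
    and X': "X' = closest_point psd_cone W" and Z_eq: "Z = inverse \<tau> *\<^sub>R (X' - W)"
  shows "X' \<in> psd_cone" "Z \<in> sym_mats" "\<And>Y. Y \<in> psd_cone \<Longrightarrow> 0 \<le> Z \<bullet> Y" "Z \<bullet> X' = 0" "X' ** Z = 0"
proof -
  show psd: "X' \<in> psd_cone"
    unfolding X' using closest_point_in_set[OF closed_psd_cone] psd_cone_0 by blast
  show Zsym: "Z \<in> sym_mats"
    using psd_cone_sym[OF psd] W by (simp add: Z_eq sym_mats_scaleR sym_mats_diff)
  have var: "0 \<le> Z \<bullet> (Y - X')" if "Y \<in> psd_cone" for Y
  proof -
    have "(W - X') \<bullet> (Y - X') \<le> 0"
      unfolding X' by (rule closest_point_dot[OF convex_psd_cone closed_psd_cone that])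
    then have "0 \<le> (X' - W) \<bullet> (Y - X')"
      by (simp add: inner_diff_left)
    then show ?thesis using tau by (simp add: Z_eq)
  qed
  show dual: "0 \<le> Z \<bullet> Y" if "Y \<in> psd_cone" for Y
    using var[OF psd_cone_add[OF psd that]] by simp
  show orth: "Z \<bullet> X' = 0"
    using var[OF psd_cone_0] dual[OF psd] by simp
  show "X' ** Z = 0"
    by (rule psd_complementarity_product[OF psd Zsym dual orth])
qed

text \<open>
  The step is a proximal point step: \<open>P\<close> applied to the displacement is the residual of the
  KKT system at the new point, with \<open>Z\<close> in the role of the dual slack.
\<close>
lemma PDHG_residual:
  assumes tau: "\<tau> > 0" and sigma: "\<sigma> > 0"
    and Z: "Z = inverse \<tau> *\<^sub>R (X' - (X - \<tau> *\<^sub>R (C - Aadj A y)))"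
    and y': "y' = y + \<sigma> *\<^sub>R (b - Aop A (2 *\<^sub>R X' - X))"
  shows "P_op A \<tau> \<sigma> ((X, y) - (X', y')) = (C - Aadj A y' - Z, Aop A X' - b)"
proof -
  have "inverse \<tau> *\<^sub>R (X - X') + Aadj A (y - y') = C - Aadj A y' - Z"
    using tau by (simp add: Z linear_diff[OF linear_Aadj] algebra_simps)
  moreover have "Aop A (X - X') + inverse \<sigma> *\<^sub>R (y - y') = Aop A X' - b"
  proof -
    have "inverse \<sigma> *\<^sub>R (y - y') = Aop A (2 *\<^sub>R X' - X) - b"
      using sigma by (simp add: y')
    also have "Aop A (2 *\<^sub>R X' - X) = 2 *\<^sub>R Aop A X' - Aop A X"
      by (simp add: linear_diff[OF linear_Aop] linear_scale[OF linear_Aop])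
    finally show ?thesis
      by (simp add: linear_diff[OF linear_Aop] scaleR_2)
  qed
  ultimately show ?thesis by (simp add: P_op_def)
qed

text \<open>
  Monotonicity of the KKT system. The constraint parts cancel because \<open>A\<close> and its adjoint enter with
  opposite signs, which leaves \<open>\<langle>X' - Xs, Ss - Z\<rangle> = \<langle>X', Ss\<rangle> + \<langle>Xs, Z\<rangle>\<close>.
\<close>
lemma KKT_residual_monotone:
  assumes A: "\<And>i. A i \<in> sym_mats"
    and feas: "Aop A Xs = b" "Aadj A ys + Ss = C" "Ss \<bullet> Xs = 0" "Z \<bullet> X' = 0"
    and nonneg: "0 \<le> Ss \<bullet> X'" "0 \<le> Z \<bullet> Xs"
  shows "0 \<le> ((X', y') - (Xs, ys)) \<bullet> (C - Aadj A y' - Z, Aop A X' - b)"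
proof -
  have "C - Aadj A y' - Z = (Ss - Z) - Aadj A (y' - ys)"
    by (simp add: feas(2)[symmetric] linear_diff[OF linear_Aadj])
  moreover have "Aop A X' - b = Aop A (X' - Xs)"
    by (simp add: feas(1)[symmetric] linear_diff[OF linear_Aop])
  ultimately have "((X', y') - (Xs, ys)) \<bullet> (C - Aadj A y' - Z, Aop A X' - b) = (X' - Xs) \<bullet> (Ss - Z)"
    using Aadj_adjoint[of A "X' - Xs" "y' - ys", OF A]
    by (simp add: inner_diff_right)
  also have "\<dots> = Ss \<bullet> X' + Z \<bullet> Xs"
    using feas(3,4) by (simp add: inner_diff_left inner_diff_right inner_commute)
  finally show ?thesis using nonneg by simp
qed

section \<open>From the error bound to linear convergence\<close>

lemma geometric_decay:
  fixes f :: "nat \<Rightarrow> real"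
  assumes "0 \<le> \<rho>" and "\<And>k. k \<ge> N \<Longrightarrow> f (Suc k) \<le> \<rho> * f k"
  shows "k \<ge> N \<Longrightarrow> f k \<le> f N * \<rho> ^ (k - N)"
proof (induction k rule: dec_induct)
  case base
  show ?case by simp
next
  case (step k)
  have "f (Suc k) \<le> \<rho> * (f N * \<rho> ^ (k - N))"
    using assms(2)[of k] step mult_left_mono[OF step.IH assms(1)] by linarith
  then show ?case using step by (simp add: Suc_diff_le mult_ac)
qed

text \<open>
  Fejer monotonicity with a gain of \<open>d\<^sup>2\<close>, combined with \<open>e' \<le> M d\<close>, gives
  \<open>(1 + 1 / M\<^sup>2) e'\<^sup>2 \<le> e\<^sup>2\<close>.
\<close>
lemma contraction_of_error_bound:
  fixes M :: real
  assumes "M > 0"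
  obtains \<rho> where "0 < \<rho>" "\<rho> < 1"
    "\<And>e e' d. 0 \<le> e \<Longrightarrow> 0 \<le> e' \<Longrightarrow> 0 \<le> d \<Longrightarrow> e'\<^sup>2 + d\<^sup>2 \<le> e\<^sup>2 \<Longrightarrow> e' \<le> M * d \<Longrightarrow> e' \<le> \<rho> * e"
proof
  define s where "s = sqrt (1 + 1 / M\<^sup>2)"
  have s: "s > 1" using assms by (simp add: s_def)
  show "0 < 1 / s" "1 / s < 1" using s by simp_all
  fix e e' d :: real
  assume *: "0 \<le> e" "0 \<le> e'" "0 \<le> d" "e'\<^sup>2 + d\<^sup>2 \<le> e\<^sup>2" "e' \<le> M * d"
  have "e'\<^sup>2 \<le> (M * d)\<^sup>2" using * by (intro power_mono) auto
  then have "e'\<^sup>2 / M\<^sup>2 \<le> d\<^sup>2"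
    using assms by (simp add: power_mult_distrib divide_simps mult.commute)
  then have "(s * e')\<^sup>2 \<le> e\<^sup>2"
    using *(4) by (simp add: s_def power_mult_distrib algebra_simps)
  then have "s * e' \<le> e" using *(1) by (rule power2_le_imp_le)
  then show "e' \<le> 1 / s * e" using s by (simp add: field_simps)
qed

theorem theorem2:
  fixes C :: "real^'n^'n"
    and A :: "'m::finite \<Rightarrow> real^'n^'n"
    and b :: "real^'m"
    and \<tau> \<sigma> :: real
    and X S :: "nat \<Rightarrow> real^'n^'n"
    and y :: "nat \<Rightarrow> real^'m"
    and Xs Ss :: "real^'n^'n"
    and ys :: "real^'m"
  assumes C_sym: "C \<in> sym_mats"
    and A_sym: "\<And>i. A i \<in> sym_mats"
    and A_surj: "Aop A ` sym_mats = UNIV"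
    and KKT_nonempty: "KKT_set C A b \<noteq> {}"
    and tau_pos: "\<tau> > 0"
    and sigma_pos: "\<sigma> > 0"
    and step_size: "\<tau> * \<sigma> * (Aop_norm A)\<^sup>2 < 1"
    and iteration: "PDHG_iteration C A b \<tau> \<sigma> X y"
    and S_eq: "\<And>k. S k = C - Aadj A (y k)"
    and limit: "(\<lambda>k. (X k, y k, S k)) \<longlonglongrightarrow> (Xs, ys, Ss)"
    and KKT: "(Xs, ys, Ss) \<in> KKT_set C A b"
    and nondegenerate: "primal_dual_nondegenerate A Xs Ss"
  shows "\<exists>\<rho> \<kappa> :: real. \<exists>kND :: nat. 0 < \<rho> \<and> \<rho> < 1 \<and> 0 < \<kappa> \<and>
    (\<forall>k\<ge>kND.
       P_norm A \<tau> \<sigma> ((X (Suc k), y (Suc k)) - (Xs, ys))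
         \<le> \<rho> * P_norm A \<tau> \<sigma> ((X k, y k) - (Xs, ys)) \<and>
       norm (X k - Xs) + norm (y k - ys) + norm (S k - Ss) \<le> \<kappa> * \<rho> ^ (k - kND))"
proof -
  have X0: "X 0 \<in> sym_mats"
    and Xstep: "\<And>k. X (Suc k) = closest_point psd_cone (X k - \<tau> *\<^sub>R (C - Aadj A (y k)))"
    and ystep: "\<And>k. y (Suc k) = y k + \<sigma> *\<^sub>R (b - Aop A (2 *\<^sub>R X (Suc k) - X k))"
    using iteration by (auto simp: PDHG_iteration_def)
  have feas: "Aop A Xs = b" "Aadj A ys + Ss = C" and Xs: "Xs \<in> psd_cone" and Ss: "Ss \<in> psd_cone"
    and XsSs: "mat_inner Xs Ss = 0"
    using KKT by (auto simp: KKT_set_def)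
  have Ss_eq: "Ss = C - Aadj A ys" using feas(2) by (simp add: algebra_simps)
  have orth: "Ss \<bullet> Xs = 0"
    using XsSs mat_inner_eq_inner[OF psd_cone_sym[OF Xs], of Ss] by (simp add: inner_commute)
  have limX: "X \<longlonglongrightarrow> Xs"
    using tendsto_fst[OF limit] by simp
  have limS: "S \<longlonglongrightarrow> Ss"
    using tendsto_snd[OF tendsto_snd[OF limit]] by simp
  define W where "W k = X k - \<tau> *\<^sub>R (C - Aadj A (y k))" for k
  define Z where "Z k = inverse \<tau> *\<^sub>R (X (Suc k) - W k)" for k
  have psd: "X k \<in> sym_mats \<Longrightarrow> X (Suc k) \<in> psd_cone" for k
    unfolding Xstep using closest_point_in_set[OF closed_psd_cone] psd_cone_0 by blast
  have Xsym: "X k \<in> sym_mats" for k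
    by (induction k) (simp_all add: X0 psd psd_cone_sym)
  have Wsym: "W k \<in> sym_mats" for k
    unfolding W_def
    by (intro sym_mats_diff sym_mats_scaleR Xsym C_sym Aadj_sym_mats A_sym)
  note Zprops = psd_projection_residual[OF Wsym tau_pos Xstep[folded W_def] Z_def]
  \<comment> \<open>\<open>Ss\<close> lies in the dual cone as the limit of the \<open>Z k\<close>; the spectral theorem, which would show
    that the cone is self-dual, is avoided in this way.\<close>
  have limZ: "Z \<longlonglongrightarrow> Ss"
  proof -
    have "Z = (\<lambda>k. inverse \<tau> *\<^sub>R (X (Suc k) - X k) + S k)"
      using tau_pos by (intro ext) (simp add: Z_def W_def S_eq algebra_simps)
    moreover have "(\<lambda>k. inverse \<tau> *\<^sub>R (X (Suc k) - X k) + S k) \<longlonglongrightarrow> inverse \<tau> *\<^sub>R (Xs - Xs) + Ss"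
      by (intro tendsto_intros limX limS LIMSEQ_Suc)
    ultimately show ?thesis by simp
  qed
  have Ss_dual: "0 \<le> Ss \<bullet> Y" if "Y \<in> psd_cone" for Y
    using LIMSEQ_le_const[OF tendsto_inner[OF limZ tendsto_const]] Zprops(3)[OF that] by blast
  have Xs_Ss: "Xs ** Ss = 0"
    by (rule psd_complementarity_product[OF Xs psd_cone_sym[OF Ss] Ss_dual orth])
  obtain c1 c2 where c: "c1 > 0" "c2 > 0"
    and lower: "\<And>U v. U \<in> sym_mats \<Longrightarrow> norm (U, v) \<le> c1 * P_norm A \<tau> \<sigma> (U, v)"
    and upper: "\<And>z. P_norm A \<tau> \<sigma> z \<le> c2 * norm z"
    and P_sq: "\<And>U v. U \<in> sym_mats \<Longrightarrow> (P_norm A \<tau> \<sigma> (U, v))\<^sup>2 = (U, v) \<bullet> P_op A \<tau> \<sigma> (U, v)"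
    using P_norm_equivalent[OF A_sym tau_pos sigma_pos step_size] by metis
  obtain K where K: "K > 0" "\<And>z. norm (P_op A \<tau> \<sigma> z) \<le> K * norm z"
    using linear_bounded_pos[OF linear_P_op, of A \<tau> \<sigma>] by auto
  obtain c0 \<delta> where c0: "c0 > 0" "\<delta> > 0"
    and eb: "\<And>U v W. U \<in> sym_mats \<Longrightarrow> W \<in> sym_mats \<Longrightarrow> norm U < \<delta> \<Longrightarrow> (Xs + U) ** (Ss + W) = 0 \<Longrightarrow>
      norm (U, v) \<le> c0 * (norm (Aop A U) + norm (Aadj A v + W))"
    using complementarity_error_bound[OF A_sym A_surj Xs_Ss nondegenerate] by metis
  define e where "e k = (X k, y k) - (Xs, ys)" for k
  define d where "d k = (X k, y k) - (X (Suc k), y (Suc k))" for k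
  define E where "E k = P_norm A \<tau> \<sigma> (e k)" for k
  define D where "D k = P_norm A \<tau> \<sigma> (d k)" for k
  have XXs: "X k - Xs \<in> sym_mats" for k
    by (intro sym_mats_diff Xsym psd_cone_sym Xs)
  have E_sq: "(E k)\<^sup>2 = e k \<bullet> P_op A \<tau> \<sigma> (e k)" and e_le: "norm (e k) \<le> c1 * E k" for k
    using P_sq[OF XXs] lower[OF XXs] by (simp_all add: E_def e_def)
  have D_sq: "(D k)\<^sup>2 = d k \<bullet> P_op A \<tau> \<sigma> (d k)" and d_le: "norm (d k) \<le> c1 * D k" for k
    using P_sq[OF sym_mats_diff[OF Xsym Xsym]] lower[OF sym_mats_diff[OF Xsym Xsym]]
    by (simp_all add: D_def d_def)
  have E_nonneg: "0 \<le> E k" and D_nonneg: "0 \<le> D k" for k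
    using order_trans[OF norm_ge_zero e_le] order_trans[OF norm_ge_zero d_le] c(1)
    by (simp_all add: zero_le_mult_iff)
  have resid: "P_op A \<tau> \<sigma> (d k) = (C - Aadj A (y (Suc k)) - Z k, Aop A (X (Suc k)) - b)" for k
    unfolding d_def by (rule PDHG_residual[OF tau_pos sigma_pos Z_def[unfolded W_def] ystep])
  \<comment> \<open>With \<open>e k = e (k + 1) + d k\<close>, the cross term of the expanded square is nonnegative.\<close>
  have fejer: "(E (Suc k))\<^sup>2 + (D k)\<^sup>2 \<le> (E k)\<^sup>2" for k
  proof -
    have "0 \<le> e (Suc k) \<bullet> P_op A \<tau> \<sigma> (d k)"
      unfolding resid unfolding e_def
      by (rule KKT_residual_monotone[OF A_sym feas orth Zprops(4) Ss_dual[OF Zprops(1)] Zprops(3)[OF Xs]])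
    moreover have "e k = e (Suc k) + d k"
      by (simp add: e_def d_def)
    ultimately show ?thesis
      unfolding E_sq D_sq using P_op_quadratic_add[of A "e (Suc k)" "d k" \<tau> \<sigma>, OF A_sym] by simp
  qed
  define M where "M = c2 * c0 * 2 * K * c1"
  have "M > 0" using c K c0 by (simp add: M_def)
  obtain N where N: "\<And>k. k \<ge> N \<Longrightarrow> norm (X k - Xs) < \<delta>"
    using LIMSEQ_D[OF limX c0(2)] by blast
  \<comment> \<open>The error bound at the new point, whose right-hand side consists of the two components of
    \<open>P (d k)\<close> and is therefore at most a multiple of \<open>D k\<close>.\<close>
  have gain: "E (Suc k) \<le> M * D k" if "k \<ge> N" for k
  proof -
    have "norm (X (Suc k) - Xs, y (Suc k) - ys)
        \<le> c0 * (norm (Aop A (X (Suc k) - Xs)) + norm (Aadj A (y (Suc k) - ys) + (Z k - Ss)))"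
      using Zprops(5)[of k] that
      by (intro eb XXs N sym_mats_diff Zprops(2) psd_cone_sym Ss) simp_all
    also have "Aop A (X (Suc k) - Xs) = snd (P_op A \<tau> \<sigma> (d k))"
      by (simp add: resid linear_diff[OF linear_Aop] feas(1))
    also have "Aadj A (y (Suc k) - ys) + (Z k - Ss) = - fst (P_op A \<tau> \<sigma> (d k))"
      by (simp add: resid linear_diff[OF linear_Aadj] Ss_eq)
    also have "norm (snd (P_op A \<tau> \<sigma> (d k))) + norm (- fst (P_op A \<tau> \<sigma> (d k))) \<le> 2 * norm (P_op A \<tau> \<sigma> (d k))"
      using norm_fst_le[of "fst (P_op A \<tau> \<sigma> (d k))" "snd (P_op A \<tau> \<sigma> (d k))"]
        norm_snd_le[of "snd (P_op A \<tau> \<sigma> (d k))" "fst (P_op A \<tau> \<sigma> (d k))"] by simp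
    also have "\<dots> \<le> 2 * (K * (c1 * D k))"
      using order_trans[OF K(2) mult_left_mono[OF d_le]] K(1) by simp
    finally have "norm (e (Suc k)) \<le> c0 * (2 * (K * (c1 * D k)))"
      using c0(1) by (simp add: e_def)
    then have "c2 * norm (e (Suc k)) \<le> M * D k"
      using mult_left_mono[of _ _ c2] c(2) by (fastforce simp: M_def mult_ac)
    then show ?thesis using upper[of "e (Suc k)"] by (simp add: E_def)
  qed
  obtain \<rho> where rho: "0 < \<rho>" "\<rho> < 1"
    and contract: "\<And>e e' d. 0 \<le> e \<Longrightarrow> 0 \<le> e' \<Longrightarrow> 0 \<le> d \<Longrightarrow> e'\<^sup>2 + d\<^sup>2 \<le> e\<^sup>2 \<Longrightarrow> e' \<le> M * d \<Longrightarrow> e' \<le> \<rho> * e"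
    using contraction_of_error_bound[OF \<open>M > 0\<close>] by metis
  have decrease: "E (Suc k) \<le> \<rho> * E k" if "k \<ge> N" for k
    by (rule contract[OF E_nonneg E_nonneg D_nonneg fejer gain[OF that]])
  obtain B where B: "B > 0" "\<And>v. norm (Aadj A v) \<le> B * norm v"
    using linear_bounded_pos[OF linear_Aadj, of A] by auto
  define \<kappa> where "\<kappa> = (2 + B) * c1 * E N + 1"
  have "0 < \<kappa>"
    using B c E_nonneg[of N] by (simp add: \<kappa>_def add_nonneg_pos)
  moreover have "norm (X k - Xs) + norm (y k - ys) + norm (S k - Ss) \<le> \<kappa> * \<rho> ^ (k - N)" if "k \<ge> N" for k
  proof -
    have "S k - Ss = - Aadj A (y k - ys)"
      by (simp add: S_eq Ss_eq linear_diff[OF linear_Aadj])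
    then have "norm (S k - Ss) \<le> B * norm (y k - ys)"
      using B(2)[of "y k - ys"] by simp
    also have "\<dots> \<le> B * norm (e k)"
      using norm_snd_le[of "y k - ys" "X k - Xs"] B(1) by (simp add: e_def)
    finally have "norm (X k - Xs) + norm (y k - ys) + norm (S k - Ss) \<le> (2 + B) * norm (e k)"
      using norm_fst_le[of "X k - Xs" "y k - ys"] norm_snd_le[of "y k - ys" "X k - Xs"]
      by (simp add: e_def algebra_simps)
    also have "\<dots> \<le> (2 + B) * (c1 * E k)"
      using B(1) by (intro mult_left_mono e_le) simp
    also have "\<dots> \<le> (2 + B) * (c1 * (E N * \<rho> ^ (k - N)))"
      using B(1) c(1) rho(1) geometric_decay[of \<rho> N E k, OF _ decrease that]
      by (intro mult_left_mono) simp_all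
    also have "\<dots> \<le> \<kappa> * \<rho> ^ (k - N)"
      using rho(1) by (simp add: \<kappa>_def algebra_simps)
    finally show ?thesis .
  qed
  ultimately show ?thesis
    using rho decrease unfolding E_def e_def by blast
qed

end
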